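(* Let $X$ be a Markov process in $E\cup\{\partial\}$ absorbed at $\partial$, with $\mathbb{P}_x(t<\tau_\partial)>0$ for all $x\in E$ and $t\geq0$. Assume that there exist $t_0,c_1,c_2>0$ and a probability measure $\nu$ on $E$ such that: (A1) for all $x\in E$, $\mathbb{P}_x(X_{t_0}\in\cdot\mid t_0<\tau_\partial)\geq c_1\nu(\cdot)$; (A2) for all $z\in E$ and all $t\geq0$, $\mathbb{P}_\nu(t<\tau_\partial)\geq c_2\mathbb{P}_z(t<\tau_\partial)$. Then, for all probability measures $\pi_1$ and $\pi_2$ on $E$ and all $t\geq0$, $$\left\|\mathbb{P}_{\pi_1}(X_t\in\cdot\mid t<\tau_\partial)-\mathbb{P}_{\pi_2}(X_t\in\cdot\mid t<\tau_\partial)\right\|_{TV}\leq\frac{(1-c_1c_2)^{\lfloor t/t_0\rfloor}}{c(\pi_1)\vee c(\pi_2)}\,\|\pi_1-\pi_2\|_{TV},$$ where, for $i=1,2$, $c(\pi_i)=\inf_{t\geq0}\dfrac{\mathbb{P}_{\pi_i}(t<\tau_\partial)}{\sup_{z\in E}\mathbb{P}_z(t<\tau_\partial)}$.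
   Context: $X=(X_t)_{t\geq0}$ is a (time-homogeneous) Markov process in a measurable state space $E\cup\{\partial\}$, $\partial\notin E$, absorbed at $\partial$ at time $\tau_\partial=\inf\{t\geq0:X_t=\partial\}$. $\mathbb{P}_x$ denotes the law of $X$ started at $x$ and $\mathbb{P}_\pi=\int_E\mathbb{P}_x\,\pi(dx)$ the law with initial distribution $\pi$. It is not assumed that $\mathbb{P}_x(\tau_\partial<\infty)=1$. $\|\cdot\|_{TV}$ is the total variation norm on finite signed measures and $a\vee b=\max(a,b)$. *)

theory Defs
  imports "HOL-Probability.Probability"
begin

text \<open>
  Finite signed measures on a measurable space \<open>M\<close> are represented by their set functions
  on \<^term>\<open>sets M\<close>. The total variation norm is the mass \<open>\<bar>\<mu>\<bar>(space M)\<close> of the total variation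
  measure, so two mutually singular probability measures are at distance 2.
\<close>

definition tv_norm :: "'a measure \<Rightarrow> ('a set \<Rightarrow> real) \<Rightarrow> real" where
  "tv_norm M \<mu> =
     (SUP \<A> \<in> {\<A>. finite \<A> \<and> partition_on (space M) \<A> \<and> \<A> \<subseteq> sets M}. \<Sum>A\<in>\<A>. \<bar>\<mu> A\<bar>)"

definition natural_filtration ::
  "'w measure \<Rightarrow> 's measure \<Rightarrow> (real \<Rightarrow> 'w \<Rightarrow> 's) \<Rightarrow> real \<Rightarrow> 'w measure" where
  "natural_filtration \<Omega> S X s =
     sigma (space \<Omega>) {X u -` B \<inter> space \<Omega> |u B. 0 \<le> u \<and> u \<le> s \<and> B \<in> sets S}"

text \<open>
  Time is \<open>[0,\<infinity>)\<close>; the values of \<open>X\<close> at negative times are irrelevant.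
  The law started at \<open>x\<close> is \<open>P x\<close>. The initial condition is expressed through the law of \<open>X 0\<close>
  because singletons of the state space need not be measurable.
\<close>

locale markov_process =
  fixes \<Omega> :: "'w measure" and S :: "'s measure"
    and X :: "real \<Rightarrow> 'w \<Rightarrow> 's" and P :: "'s \<Rightarrow> 'w measure"
  assumes measurable_X: "\<And>t. 0 \<le> t \<Longrightarrow> X t \<in> \<Omega> \<rightarrow>\<^sub>M S"
    and measurable_P: "P \<in> S \<rightarrow>\<^sub>M prob_algebra \<Omega>"
    and initial: "\<And>x. x \<in> space S \<Longrightarrow> distr (P x) S (X 0) = return S x"
    and markov: "\<And>x s t B. \<lbrakk>x \<in> space S; 0 \<le> s; 0 \<le> t; B \<in> sets S\<rbrakk> \<Longrightarrow>
      AE \<omega> in P x.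
        real_cond_exp (P x) (natural_filtration \<Omega> S X s)
          (\<lambda>\<omega>'. indicator B (X (s + t) \<omega>')) \<omega>
        = \<P>(\<omega>' in P (X s \<omega>). X t \<omega>' \<in> B)"

definition absorption_time :: "(real \<Rightarrow> 'w \<Rightarrow> 's) \<Rightarrow> 's \<Rightarrow> 'w \<Rightarrow> ereal" where
  "absorption_time X cem \<omega> = Inf {ereal t |t. 0 \<le> t \<and> X t \<omega> = cem}"

text \<open>
  \<open>S\<close> is the whole state space \<open>E \<union> {\<partial>}\<close> and \<open>cem\<close> is the cemetery point \<open>\<partial>\<close>.
  Absorption at time \<open>\<tau>\<close> includes \<open>X\<^sub>\<tau> = \<partial>\<close>, i.e. the infimum defining a finite \<open>\<tau>\<close> is
  attained, so that \<open>t < \<tau>\<close> and \<open>X\<^sub>t \<in> E\<close> are the same event. Without path regularity this does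
  not follow from \<open>X\<^sub>s = \<partial> \<Longrightarrow> X\<^sub>t = \<partial>\<close> for \<open>s \<le> t\<close> alone.
\<close>

locale absorbed_markov_process = markov_process \<Omega> S X P
  for \<Omega> :: "'w measure" and S :: "'s measure"
    and X :: "real \<Rightarrow> 'w \<Rightarrow> 's" and P :: "'s \<Rightarrow> 'w measure" +
  fixes cem :: 's
  assumes cemetery: "cem \<in> space S" "{cem} \<in> sets S"
    and absorbed: "\<And>\<omega> t. \<lbrakk>\<omega> \<in> space \<Omega>; 0 \<le> t; absorption_time X cem \<omega> \<le> ereal t\<rbrakk> \<Longrightarrow> X t \<omega> = cem"

text \<open>The measurable space \<open>E\<close>.\<close>

definition live_space :: "'s measure \<Rightarrow> 's \<Rightarrow> 's measure" where
  "live_space S cem = restrict_space S (space S - {cem})"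

text \<open>The constant \<open>c(\<pi>)\<close>; the mixture \<open>\<integral> P x \<pi>(dx)\<close> is the monadic bind \<open>\<pi> \<bind> P\<close>.\<close>

definition survival_constant ::
  "'s measure \<Rightarrow> (real \<Rightarrow> 'w \<Rightarrow> 's) \<Rightarrow> ('s \<Rightarrow> 'w measure) \<Rightarrow> 's \<Rightarrow> 's measure \<Rightarrow> real" where
  "survival_constant S X P cem \<pi> =
     (INF t\<in>{0..}.
        \<P>(\<omega> in \<pi> \<bind> P. ereal t < absorption_time X cem \<omega>) /
        (SUP z\<in>space (live_space S cem). \<P>(\<omega> in P z. ereal t < absorption_time X cem \<omega>)))"

end

theory Submission
  imports Defs
begin

text \<open>
  Write \<open>P\<^sub>t A x = \<^bold>P\<^sub>x(X\<^sub>t \<in> A)\<close> and \<open>g\<^sub>t x = P\<^sub>t E x\<close> for the survival probability. The conditional law at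
  time \<open>t\<close> from an initial law \<open>\<pi>\<close> is \<open>\<pi>(P\<^sub>t A) / \<pi>(g\<^sub>t)\<close>, and two ingredients control it.

  First, the law of \<open>X\<close> conditioned on survival up to the final time \<open>t\<close> is a time-inhomogeneous Markov process,
  and (A1) with (A2) gives each of its steps of length \<open>t\<^sub>0\<close> a common component of mass \<open>c\<^sub>1 c\<^sub>2\<close>: by
  (A1) a nonnegative \<open>f\<close> has \<open>P\<^sub>t\<^sub>0 f \<ge> c\<^sub>1 \<nu>(f) g\<^sub>t\<^sub>0\<close>, while \<open>g\<close> at time \<open>t\<^sub>0 + s\<close> is at most \<open>g\<^sub>t\<^sub>0 sup g\<^sub>s\<close>,
  and \<open>\<nu>(g\<^sub>s) \<ge> c\<^sub>2 sup g\<^sub>s\<close> by (A2). So the oscillation over the starting point \<open>x\<close> of the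
  conditional probability \<open>P\<^sub>t A x / g\<^sub>t x\<close> shrinks by the factor \<open>1 - c\<^sub>1 c\<^sub>2\<close> at each
  step (\<open>oscillation_step\<close>, \<open>oscillation\<close>). The division by \<open>g\<^sub>t\<close> is avoided: the
  bounds read \<open>m g\<^sub>t \<le> P\<^sub>t A \<le> (m + w) g\<^sub>t\<close>, with \<open>w = (1 - c\<^sub>1 c\<^sub>2)\<^sup>k\<close> and \<open>k = \<lfloor>t / t\<^sub>0\<rfloor>\<close>.

  Secondly, subtracting \<open>m g\<^sub>t\<close> from \<open>P\<^sub>t A\<close> does not change the difference of the two
  conditional probabilities, so \<open>P\<^sub>t A\<close> may be replaced by a function \<open>F\<close> with
  \<open>0 \<le> F \<le> w sup g\<^sub>t\<close>. If \<open>\<pi>\<^sub>1(g\<^sub>t)\<close> is the larger of the two survival probabilities, then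
  \<open>\<pi>\<^sub>1(F)/\<pi>\<^sub>1(g\<^sub>t) - \<pi>\<^sub>2(F)/\<pi>\<^sub>2(g\<^sub>t) \<le> (\<pi>\<^sub>1(F) - \<pi>\<^sub>2(F))/\<pi>\<^sub>1(g\<^sub>t)\<close>, which a Hahn decomposition bounds by
  \<open>w (sup g\<^sub>t / \<pi>\<^sub>1(g\<^sub>t))\<close> times half the total variation distance of \<open>\<pi>\<^sub>1\<close> and \<open>\<pi>\<^sub>2\<close>
  (\<open>conditional_diff_le\<close>). The one-sided estimate over all sets \<open>A\<close> is enough, because a signed measure of
  total mass zero has total variation twice its supremum; and \<open>sup g\<^sub>t / \<pi>\<^sub>1(g\<^sub>t)\<close> is at most
  the inverse of the larger of \<open>c(\<pi>\<^sub>1)\<close> and \<open>c(\<pi>\<^sub>2)\<close>.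
\<close>

section \<open>Total variation of signed set functions of total mass zero\<close>

text \<open>
  Since the values on a partition add up to zero, the sum of their absolute values is twice the
  sum of the positive ones, that is, twice the value on the union of the corresponding cells.
\<close>

lemma tv_partition_sum_le:
  fixes \<mu> :: "'a set \<Rightarrow> real"
  assumes add: "additive (sets M) \<mu>" and null: "\<mu> (space M) = 0"
    and bound: "\<And>A. A \<in> sets M \<Longrightarrow> \<mu> A \<le> D"
    and part: "finite \<A>" "partition_on (space M) \<A>" "\<A> \<subseteq> sets M"
  shows "(\<Sum>A\<in>\<A>. \<bar>\<mu> A\<bar>) \<le> 2 * D"
proof -
  have empty: "\<mu> {} = 0"
    using additiveD[OF add, of "{}" "{}"] by simp
  have union: "\<mu> (\<Union>\<B>) = (\<Sum>A\<in>\<B>. \<mu> A)" if "\<B> \<subseteq> \<A>" for \<B>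
  proof -
    have "finite \<B>" using that part(1) by (rule finite_subset)
    then show ?thesis using that
    proof (induction \<B>)
      case (insert B \<B>)
      have "B \<inter> \<Union>\<B> = {}"
      proof -
        have "B \<inter> C = {}" if "C \<in> \<B>" for C
          using disjointD[OF partition_onD2[OF part(2)], of B C] that insert.hyps insert.prems
          by auto
        then show ?thesis by auto
      qed
      moreover have "\<Union>\<B> \<in> sets M"
        using insert.hyps insert.prems part(3) by (intro sets.finite_Union) auto
      moreover have "B \<in> sets M" using insert.prems part(3) by auto
      ultimately have "\<mu> (B \<union> \<Union>\<B>) = \<mu> B + \<mu> (\<Union>\<B>)"
        by (intro additiveD[OF add])
      then show ?case using insert by simp
    qed (simp add: empty)
  qed
  define \<P> where "\<P> = {A\<in>\<A>. 0 < \<mu> A}"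
  have "(\<Sum>A\<in>\<A>. \<bar>\<mu> A\<bar>) = (\<Sum>A\<in>\<A>. 2 * (if 0 < \<mu> A then \<mu> A else 0) - \<mu> A)"
    by (intro sum.cong) auto
  also have "\<dots> = 2 * (\<Sum>A\<in>\<P>. \<mu> A) - (\<Sum>A\<in>\<A>. \<mu> A)"
    unfolding \<P>_def using part(1)
    by (simp add: sum_subtractf sum_distrib_left[symmetric] sum.inter_filter)
  also have "\<dots> = 2 * \<mu> (\<Union>\<P>) - \<mu> (\<Union>\<A>)"
    using union[of \<P>] union[of \<A>] by (simp add: \<P>_def)
  also have "\<dots> = 2 * \<mu> (\<Union>\<P>)"
    using part(2) null by (simp add: partition_on_def)
  also have "\<dots> \<le> 2 * D"
    using part(1,3) by (auto simp: \<P>_def intro!: bound sets.finite_Union)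
  finally show ?thesis .
qed

lemma tv_norm_le:
  fixes \<mu> :: "'a set \<Rightarrow> real"
  assumes add: "additive (sets M) \<mu>" and null: "\<mu> (space M) = 0"
    and bound: "\<And>A. A \<in> sets M \<Longrightarrow> \<mu> A \<le> D"
  shows "tv_norm M \<mu> \<le> 2 * D"
  unfolding tv_norm_def
proof (rule cSUP_least)
  have "{space M} - {{}} \<in> {\<A>. finite \<A> \<and> partition_on (space M) \<A> \<and> \<A> \<subseteq> sets M}"
    by (auto simp: partition_on_def disjoint_def)
  then show "{\<A>. finite \<A> \<and> partition_on (space M) \<A> \<and> \<A> \<subseteq> sets M} \<noteq> {}"
    by blast
qed (use tv_partition_sum_le[OF assms] in auto)

lemma le_tv_norm:
  fixes \<mu> :: "'a set \<Rightarrow> real"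
  assumes add: "additive (sets M) \<mu>" and null: "\<mu> (space M) = 0"
    and bound: "\<And>A. A \<in> sets M \<Longrightarrow> \<mu> A \<le> D"
    and A: "A \<in> sets M"
  shows "2 * \<mu> A \<le> tv_norm M \<mu>"
proof -
  have empty: "\<mu> {} = 0"
    using additiveD[OF add, of "{}" "{}"] by simp
  have sub: "A \<subseteq> space M" using A by (rule sets.sets_into_space)
  then have un: "A \<union> (space M - A) = space M" by auto
  have compl: "\<mu> (space M - A) = - \<mu> A"
    using additiveD[OF add, of A "space M - A"] A null unfolding un by simp
  define \<A> where "\<A> = {A, space M - A} - {{}}"
  have ne: "A \<noteq> space M - A" if "\<mu> A \<noteq> 0"
    using that empty by (metis Diff_disjoint Int_absorb)
  have "2 * \<mu> A \<le> (\<Sum>B\<in>{A, space M - A}. \<bar>\<mu> B\<bar>)"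
    by (cases "\<mu> A = 0") (use ne compl in \<open>auto simp: sum_nonneg\<close>)
  also have "\<dots> = (\<Sum>B\<in>\<A>. \<bar>\<mu> B\<bar>)"
    unfolding \<A>_def by (intro sum.mono_neutral_right) (auto simp: empty)
  also have "\<dots> \<le> tv_norm M \<mu>"
    unfolding tv_norm_def
  proof (rule cSUP_upper)
    show "\<A> \<in> {\<A>. finite \<A> \<and> partition_on (space M) \<A> \<and> \<A> \<subseteq> sets M}"
      using A sub by (auto simp: \<A>_def partition_on_def disjoint_def)
    show "bdd_above ((\<lambda>\<A>. \<Sum>A\<in>\<A>. \<bar>\<mu> A\<bar>) `
        {\<A>. finite \<A> \<and> partition_on (space M) \<A> \<and> \<A> \<subseteq> sets M})"
      using tv_partition_sum_le[OF add null bound] by (intro bdd_aboveI[of _ "2 * D"]) auto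
  qed
  finally show ?thesis .
qed

lemma tv_norm_diff_commute: "tv_norm M (\<lambda>A. \<mu> A - \<nu> A) = tv_norm M (\<lambda>A. \<nu> A - \<mu> A)"
  unfolding tv_norm_def by (simp add: abs_minus_commute)

lemma tv_norm_cong: "(\<And>A. A \<in> sets M \<Longrightarrow> \<mu> A = \<nu> A) \<Longrightarrow> tv_norm M \<mu> = tv_norm M \<nu>"
  unfolding tv_norm_def by (intro SUP_cong sum.cong refl) (auto intro!: arg_cong[where f = abs])

section \<open>Integrals against two comparable measures\<close>

lemma integral_mono_scaled_measure:
  fixes f :: "'a \<Rightarrow> real"
  assumes fin: "finite_measure M" "finite_measure N" and sets: "sets N = sets M"
    and c: "0 \<le> c" "\<And>A. A \<in> sets M \<Longrightarrow> c * measure N A \<le> measure M A"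
    and f: "f \<in> borel_measurable M" "\<And>x. x \<in> space M \<Longrightarrow> 0 \<le> f x" "\<And>x. x \<in> space M \<Longrightarrow> f x \<le> B"
  shows "c * (\<integral>x. f x \<partial>N) \<le> (\<integral>x. f x \<partial>M)"
proof -
  interpret M: finite_measure M by fact
  interpret N: finite_measure N by fact
  have sp: "space N = space M" using sets by (rule sets_eq_imp_space_eq)
  have fN: "f \<in> borel_measurable N"
    using f(1) by (simp cong: measurable_cong_sets add: sets)
  have iM: "integrable M f" by (rule M.integrable_const_bound[of _ B]) (use f in auto)
  have iN: "integrable N f" by (rule N.integrable_const_bound[of _ B]) (use f fN sp in auto)
  have "ennreal (c * (\<integral>x. f x \<partial>N)) = ennreal c * (\<integral>\<^sup>+x. f x \<partial>N)"
    using f(2) sp c(1) by (subst nn_integral_eq_integral[OF iN]) (auto simp: ennreal_mult')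
  also have "\<dots> = (\<integral>\<^sup>+x. f x \<partial>scale_measure (ennreal c) N)"
    using fN by (intro nn_integral_scale_measure[symmetric]) simp
  also have "\<dots> \<le> (\<integral>\<^sup>+x. f x \<partial>M)"
  proof (rule nn_integral_mono_measure)
    show "scale_measure (ennreal c) N \<le> M"
      using c sets by (subst le_measure)
        (auto simp: N.emeasure_eq_measure M.emeasure_eq_measure ennreal_mult'[symmetric] intro: ennreal_leI)
  qed (simp add: sets)
  also have "\<dots> = ennreal (\<integral>x. f x \<partial>M)"
    using nn_integral_eq_integral[OF iM] f(2) by simp
  finally show ?thesis
    using f(2) by (subst (asm) ennreal_le_iff) (auto intro!: integral_nonneg_AE)
qed

lemma set_integral_mono_measure:
  fixes f :: "'a \<Rightarrow> real"
  assumes fin: "finite_measure M" "finite_measure N" and sets: "sets N = sets M"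
    and Y: "Y \<in> sets M" "\<And>A. A \<in> sets M \<Longrightarrow> A \<subseteq> Y \<Longrightarrow> measure N A \<le> measure M A"
    and f: "f \<in> borel_measurable M" "\<And>x. x \<in> space M \<Longrightarrow> 0 \<le> f x" "\<And>x. x \<in> space M \<Longrightarrow> f x \<le> B"
  shows "(\<integral>x\<in>Y. f x \<partial>N) \<le> (\<integral>x\<in>Y. f x \<partial>M)"
proof -
  have sp: "space N = space M" using sets by (rule sets_eq_imp_space_eq)
  have "1 * (\<integral>x. f x \<partial>restrict_space N Y) \<le> (\<integral>x. f x \<partial>restrict_space M Y)"
  proof (rule integral_mono_scaled_measure[where B = B])
    show "finite_measure (restrict_space M Y)" "finite_measure (restrict_space N Y)"
      using fin Y(1) sets by (auto intro!: finite_measure_restrict_space)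
    show "sets (restrict_space N Y) = sets (restrict_space M Y)"
      by (rule sets_restrict_space_cong[OF sets])
    show "1 * measure (restrict_space N Y) A \<le> measure (restrict_space M Y) A"
      if "A \<in> sets (restrict_space M Y)" for A
      using that Y sets sp sets.sets_into_space[OF Y(1)]
      by (auto simp: measure_restrict_space sets_restrict_space_iff Int_absorb2)
    show "f \<in> borel_measurable (restrict_space M Y)"
      using f(1) by (rule measurable_restrict_space1)
  qed (use f sets.sets_into_space[OF Y(1)] in \<open>auto simp: space_restrict_space\<close>)
  then show ?thesis
    using Y(1) sets sp by (simp add: integral_restrict_space set_lebesgue_integral_def)
qed

lemma (in finite_measure) set_integral_const_minus:
  fixes f :: "'a \<Rightarrow> real"
  assumes Y: "Y \<in> sets M" and f: "integrable M f"
  shows "(\<integral>x\<in>Y. C - f x \<partial>M) = C * measure M Y - (\<integral>x\<in>Y. f x \<partial>M)"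
proof -
  have "set_integrable M Y f" "set_integrable M Y (\<lambda>_. C)"
    unfolding set_integrable_def
    by (rule integrable_mult_indicator[OF Y f], rule integrable_mult_indicator[OF Y]) simp
  then have "(\<integral>x\<in>Y. C - f x \<partial>M) = (\<integral>x\<in>Y. C \<partial>M) - (\<integral>x\<in>Y. f x \<partial>M)"
    by (intro set_integral_diff)
  then show ?thesis
    using Y by (simp add: set_lebesgue_integral_def mult.commute)
qed

text \<open>
  On the part of a Hahn decomposition where \<open>q\<close> dominates, replacing \<open>p\<close> by \<open>q\<close> only
  increases the integral of \<open>f\<close>; on the part \<open>Y\<close> where \<open>p\<close> dominates, the same
  comparison for \<open>C - f\<close> leaves at most \<open>C * (measure p Y - measure q Y)\<close>.
\<close>

lemma integral_diff_le_sup_diff: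
  fixes f :: "'a \<Rightarrow> real"
  assumes fin: "finite_measure p" "finite_measure q" and sets: "sets q = sets p"
    and D: "\<And>A. A \<in> sets p \<Longrightarrow> measure p A - measure q A \<le> D"
    and f: "f \<in> borel_measurable p" "\<And>x. x \<in> space p \<Longrightarrow> 0 \<le> f x" "\<And>x. x \<in> space p \<Longrightarrow> f x \<le> C"
    and C: "0 \<le> C"
  shows "(\<integral>x. f x \<partial>p) - (\<integral>x. f x \<partial>q) \<le> C * D"
proof -
  interpret p: finite_measure p by fact
  interpret q: finite_measure q by fact
  have sp: "space q = space p" using sets by (rule sets_eq_imp_space_eq)
  have fq: "f \<in> borel_measurable q"
    using f(1) by (simp cong: measurable_cong_sets add: sets)
  have ip: "integrable p f" by (rule p.integrable_const_bound[of _ C]) (use f in auto)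
  have iq: "integrable q f" by (rule q.integrable_const_bound[of _ C]) (use f fq sp in auto)
  obtain Y where Y: "Y \<in> sets p"
      and le: "\<And>X. X \<in> sets p \<Longrightarrow> X \<subseteq> Y \<Longrightarrow> emeasure q X \<le> emeasure p X"
      and ge: "\<And>X. X \<in> sets p \<Longrightarrow> X \<inter> Y = {} \<Longrightarrow> emeasure p X \<le> emeasure q X"
    using finite_unsigned_Hahn_decomposition[OF fin sets] by auto
  define Z where "Z = space p - Y"
  have Z: "Z \<in> sets p" using Y by (auto simp: Z_def)
  have split: "(\<integral>x. f x \<partial>M) = (\<integral>x\<in>Y. f x \<partial>M) + (\<integral>x\<in>Z. f x \<partial>M)"
    if M: "sets M = sets p" "integrable M f" for M
  proof -
    have sM: "space M = space p" using M(1) by (rule sets_eq_imp_space_eq)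
    have "set_integrable M Y f" "set_integrable M Z f"
      unfolding set_integrable_def using Y Z
      by (intro integrable_mult_indicator M(2); simp add: M(1))+
    then have "(\<integral>x\<in>Y \<union> Z. f x \<partial>M) = (\<integral>x\<in>Y. f x \<partial>M) + (\<integral>x\<in>Z. f x \<partial>M)"
      by (intro set_integral_Un) (auto simp: Z_def)
    moreover have "Y \<union> Z = space M"
      using sets.sets_into_space[OF Y] sM by (auto simp: Z_def)
    ultimately show ?thesis using set_integral_space[OF M(2)] by simp
  qed
  have Zle: "(\<integral>x\<in>Z. f x \<partial>p) \<le> (\<integral>x\<in>Z. f x \<partial>q)"
  proof (rule set_integral_mono_measure[where B = C])
    show "measure p A \<le> measure q A" if "A \<in> sets q" "A \<subseteq> Z" for A
    proof -
      have "emeasure p A \<le> emeasure q A"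
        using that sets by (intro ge) (auto simp: Z_def)
      then show ?thesis by (simp add: p.emeasure_eq_measure q.emeasure_eq_measure)
    qed
  qed (use fin sets Z f fq sp in auto)
  have "(\<integral>x\<in>Y. C - f x \<partial>q) \<le> (\<integral>x\<in>Y. C - f x \<partial>p)"
  proof (rule set_integral_mono_measure[where B = C])
    show "measure q A \<le> measure p A" if "A \<in> sets p" "A \<subseteq> Y" for A
      using le[OF that] by (simp add: p.emeasure_eq_measure q.emeasure_eq_measure)
  qed (use fin sets Y f in auto)
  moreover have "(\<integral>x\<in>Y. C - f x \<partial>p) = C * measure p Y - (\<integral>x\<in>Y. f x \<partial>p)"
    by (intro p.set_integral_const_minus) (use Y ip sets in auto)
  moreover have "(\<integral>x\<in>Y. C - f x \<partial>q) = C * measure q Y - (\<integral>x\<in>Y. f x \<partial>q)"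
    by (intro q.set_integral_const_minus) (use Y iq sets in auto)
  ultimately have "(\<integral>x\<in>Y. f x \<partial>p) - (\<integral>x\<in>Y. f x \<partial>q) \<le> C * (measure p Y - measure q Y)"
    by (simp add: algebra_simps)
  also have "\<dots> \<le> C * D" using D[OF Y] C by (intro mult_left_mono)
  finally show ?thesis
    using Zle split[OF refl ip] split[OF sets iq] by simp
qed

section \<open>Transition probabilities of a Markov process\<close>

context markov_process
begin

definition trans :: "real \<Rightarrow> 's set \<Rightarrow> 's \<Rightarrow> real" where
  "trans t A x = \<P>(\<omega> in P x. X t \<omega> \<in> A)"

lemma measurable_P_subprob: "P \<in> S \<rightarrow>\<^sub>M subprob_algebra \<Omega>"
  using measurable_P by (rule measurable_prob_algebraD)

lemma prob_space_P: "x \<in> space S \<Longrightarrow> prob_space (P x)"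
  using measurable_space[OF measurable_P] by (auto simp: space_prob_algebra)

lemma sets_P: "x \<in> space S \<Longrightarrow> sets (P x) = sets \<Omega>"
  using measurable_space[OF measurable_P] by (auto simp: space_prob_algebra)

lemma space_P: "x \<in> space S \<Longrightarrow> space (P x) = space \<Omega>"
  using sets_P by (rule sets_eq_imp_space_eq)

lemma X_event_sets: "0 \<le> t \<Longrightarrow> A \<in> sets S \<Longrightarrow> {\<omega>\<in>space \<Omega>. X t \<omega> \<in> A} \<in> sets \<Omega>"
  using measurable_sets[OF measurable_X, of t A] by (simp add: vimage_def Int_def conj_commute)

lemma X_in_space: "0 \<le> t \<Longrightarrow> \<omega> \<in> space \<Omega> \<Longrightarrow> X t \<omega> \<in> space S"
  using measurable_space[OF measurable_X] by blast

lemma measurable_X_P: "0 \<le> t \<Longrightarrow> x \<in> space S \<Longrightarrow> X t \<in> P x \<rightarrow>\<^sub>M S"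
  using measurable_X by (simp cong: measurable_cong_sets add: sets_P)

lemma trans_eq: "x \<in> space S \<Longrightarrow> trans t A x = measure (P x) {\<omega>\<in>space \<Omega>. X t \<omega> \<in> A}"
  by (simp add: trans_def space_P)

lemma trans_distr: "0 \<le> t \<Longrightarrow> x \<in> space S \<Longrightarrow> A \<in> sets S \<Longrightarrow> measure (distr (P x) S (X t)) A = trans t A x"
  by (simp add: trans_eq measure_distr measurable_X_P space_P vimage_def Int_def conj_commute)

lemma trans_bounds: "x \<in> space S \<Longrightarrow> 0 \<le> trans t A x \<and> trans t A x \<le> 1"
  using prob_space.prob_le_1[OF prob_space_P] by (simp add: trans_def)

lemma trans_mono:
  assumes "x \<in> space S" "0 \<le> t" "A \<subseteq> B" "B \<in> sets S"
  shows "trans t A x \<le> trans t B x"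
proof -
  interpret prob_space "P x" using assms(1) by (rule prob_space_P)
  show ?thesis
    using assms X_event_sets[of t B] by (auto simp: trans_eq sets_P intro!: finite_measure_mono)
qed

lemma trans_additive: 
  assumes "x \<in> space S" "0 \<le> t" "A \<in> sets S" "B \<in> sets S" "A \<inter> B = {}"
  shows "trans t (A \<union> B) x = trans t A x + trans t B x"
proof -
  interpret prob_space "P x" using assms(1) by (rule prob_space_P)
  have "{\<omega>\<in>space \<Omega>. X t \<omega> \<in> A \<union> B} = {\<omega>\<in>space \<Omega>. X t \<omega> \<in> A} \<union> {\<omega>\<in>space \<Omega>. X t \<omega> \<in> B}"
    by auto
  then show ?thesis
    using assms X_event_sets[of t A] X_event_sets[of t B]
    by (auto simp: trans_eq sets_P intro!: finite_measure_Union)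
qed

lemma measurable_trans: 
  assumes "0 \<le> t" "A \<in> sets S" 
  shows "trans t A \<in> borel_measurable S"
proof -
  have "(\<lambda>x. measure (P x) {\<omega>\<in>space \<Omega>. X t \<omega> \<in> A}) \<in> borel_measurable S"
    using measurable_P_subprob measurable_measure_subprob_algebra[OF X_event_sets[OF assms]]
    by (rule measurable_compose)
  then show ?thesis
    by (subst measurable_cong[OF trans_eq])
qed

text \<open>The Markov property enters the whole argument only through its expectation.\<close>

lemma chapman_kolmogorov:
  assumes x: "x \<in> space S" and s: "0 \<le> s" and t: "0 \<le> t" and B: "B \<in> sets S"
  shows "trans (s + t) B x = (\<integral>\<omega>. trans t B (X s \<omega>) \<partial>P x)"
proof -
  interpret prob_space "P x" using x by (rule prob_space_P)
  let ?F = "natural_filtration \<Omega> S X s"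
  let ?f = "\<lambda>\<omega>. indicator B (X (s + t) \<omega>) :: real"
  have gen: "{X u -` C \<inter> space \<Omega> |u C. 0 \<le> u \<and> u \<le> s \<and> C \<in> sets S} \<subseteq> sets \<Omega>"
    using measurable_X by (auto intro: measurable_sets)
  have "subalgebra (P x) ?F"
    unfolding subalgebra_def natural_filtration_def
    using gen x sets.sigma_sets_subset[OF gen] sets.space_closed[of \<Omega>]
    by (subst sets_measure_of) (auto simp: space_P sets_P space_measure_of_conv)
  then interpret F: finite_measure_subalgebra "P x" ?F
    by unfold_locales
  have int: "integrable (P x) ?f"
    using measurable_compose[OF measurable_X_P[of "s+t" x] borel_measurable_indicator[OF B]] s t x
    by (intro integrable_const_bound[of _ 1]) auto
  have "trans (s + t) B x = (\<integral>\<omega>. ?f \<omega> \<partial>P x)"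
  proof -
    have "(\<integral>\<omega>. ?f \<omega> \<partial>P x) = (\<integral>\<omega>. indicator {\<omega>\<in>space \<Omega>. X (s+t) \<omega> \<in> B} \<omega> \<partial>P x)"
      using x by (intro Bochner_Integration.integral_cong) (auto simp: space_P indicator_def)
    also have "\<dots> = trans (s + t) B x"
      using X_event_sets[of "s+t" B] s t B x by (simp add: trans_eq sets_P)
    finally show ?thesis ..
  qed
  also have "\<dots> = (\<integral>\<omega>. real_cond_exp (P x) ?F ?f \<omega> \<partial>P x)"
    using F.real_cond_exp_int(2)[OF int] by simp
  also have "\<dots> = (\<integral>\<omega>. trans t B (X s \<omega>) \<partial>P x)"
  proof (rule integral_cong_AE)
    show "AE \<omega> in P x. real_cond_exp (P x) ?F ?f \<omega> = trans t B (X s \<omega>)"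
      using markov[OF x s t B] by (simp add: trans_def)
    show "(\<lambda>\<omega>. trans t B (X s \<omega>)) \<in> borel_measurable (P x)"
      using measurable_X_P[OF s x] measurable_trans[OF t B] by (rule measurable_compose)
    show "real_cond_exp (P x) ?F ?f \<in> borel_measurable (P x)"
      using F.real_cond_exp_int(1)[OF int] by simp
  qed
  finally show ?thesis .
qed

end

section \<open>Survival and conditional laws of an absorbed process\<close>

context absorbed_markov_process
begin

abbreviation "E \<equiv> live_space S cem"

abbreviation surv :: "real \<Rightarrow> 's \<Rightarrow> real" where
  "surv t \<equiv> trans t (space E)"

lemma space_E: "space E = space S - {cem}"
  by (auto simp: live_space_def space_restrict_space)

lemma space_E_sets: "space S - {cem} \<in> sets S"
  using cemetery by auto

lemma sets_E: "A \<in> sets E \<longleftrightarrow> A \<in> sets S \<and> A \<subseteq> space E"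
  unfolding live_space_def using space_E_sets
  by (subst sets_restrict_space_iff) (auto simp: space_restrict_space)

lemma measurable_E: "f \<in> borel_measurable S \<Longrightarrow> f \<in> borel_measurable E"
  unfolding live_space_def by (rule measurable_restrict_space1)

lemma alive_iff:
  assumes "\<omega> \<in> space \<Omega>" "0 \<le> t"
  shows "ereal t < absorption_time X cem \<omega> \<longleftrightarrow> X t \<omega> \<in> space E"
proof
  assume "ereal t < absorption_time X cem \<omega>"
  moreover have "absorption_time X cem \<omega> \<le> ereal t" if "X t \<omega> = cem"
    unfolding absorption_time_def using that assms(2) by (intro Inf_lower) auto
  ultimately show "X t \<omega> \<in> space E"
    using X_in_space[OF assms(2,1)] by (auto simp: space_E)
next
  assume "X t \<omega> \<in> space E"
  then show "ereal t < absorption_time X cem \<omega>"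
    using absorbed[OF assms] by (auto simp: space_E not_le[symmetric])
qed

lemma surv_eq: 
  assumes "x \<in> space S" "0 \<le> t"
  shows "\<P>(\<omega> in P x. ereal t < absorption_time X cem \<omega>) = surv t x"
  using assms by (simp add: trans_def space_P alive_iff cong: conj_cong)

text \<open>
  A process started at the cemetery is absorbed at time 0. Therefore functions built from
  \<^term>\<open>trans t A\<close> with \<open>A\<close> inside \<open>E\<close> vanish at the cemetery, and integrals over
  the whole state space coincide with integrals over \<open>E\<close>.
\<close>

lemma trans_cemetery:
  assumes t: "0 \<le> t" and A: "A \<in> sets E"
  shows "trans t A cem = 0"
proof -
  interpret prob_space "P cem" using cemetery(1) by (rule prob_space_P)
  have "measure (distr (P cem) S (X 0)) {cem} = 1"
    using cemetery by (simp add: initial measure_return)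
  then have "AE \<omega> in distr (P cem) S (X 0). \<omega> \<in> {cem}"
    using cemetery by (subst prob_space.AE_in_set_eq_1[OF prob_space_distr[OF measurable_X_P]]) simp_all
  then have "AE \<omega> in P cem. X 0 \<omega> = cem"
    using AE_distrD[OF measurable_X_P[of 0 cem]] cemetery by simp
  then have "AE \<omega> in P cem. X t \<omega> \<notin> A"
  proof (rule AE_mp, intro AE_I2 impI)
    fix \<omega> assume w: "\<omega> \<in> space (P cem)" "X 0 \<omega> = cem"
    have "absorption_time X cem \<omega> \<le> ereal 0"
      unfolding absorption_time_def using w by (intro Inf_lower) auto
    then have "absorption_time X cem \<omega> \<le> ereal t"
      using t by (meson ereal_less_eq(3) order_trans)
    then have "X t \<omega> = cem" using absorbed[of \<omega> t] w t cemetery by (simp add: space_P)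
    then show "X t \<omega> \<notin> A" using A by (auto simp: sets_E space_E)
  qed
  then show ?thesis
    using t A X_event_sets[of t A] cemetery unfolding trans_def
    by (subst prob_Collect_eq_0) (auto simp: space_P sets_P sets_E)
qed

lemma surv_antimono:
  assumes x: "x \<in> space S" and st: "0 \<le> s" "s \<le> t"
  shows "surv t x \<le> surv s x"
proof -
  interpret prob_space "P x" using x by (rule prob_space_P)
  have t: "0 \<le> t" using st by simp
  have "{\<omega>\<in>space \<Omega>. X t \<omega> \<in> space E} \<subseteq> {\<omega>\<in>space \<Omega>. X s \<omega> \<in> space E}"
  proof safe
    fix \<omega> assume \<omega>: "\<omega> \<in> space \<Omega>" "X t \<omega> \<in> space E"
    then have "ereal t < absorption_time X cem \<omega>" using alive_iff[OF _ t] by simp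
    then have "ereal s < absorption_time X cem \<omega>"
      using st(2) by (meson ereal_less_eq(3) le_less_trans)
    then show "X s \<omega> \<in> space E" using alive_iff[OF \<omega>(1) st(1)] by simp
  qed
  moreover have "{\<omega>\<in>space \<Omega>. X s \<omega> \<in> space E} \<in> events"
    using X_event_sets[OF st(1), of "space E"] space_E_sets x by (simp add: sets_P space_E)
  ultimately show ?thesis
    using x by (simp add: trans_eq finite_measure_mono)
qed

lemma trans_le_surv: "x \<in> space S \<Longrightarrow> 0 \<le> t \<Longrightarrow> A \<in> sets E \<Longrightarrow> trans t A x \<le> surv t x"
  using space_E_sets by (intro trans_mono) (auto simp: sets_E space_E)

lemma trans_integrable:
  assumes "0 \<le> t" "A \<in> sets E" "prob_space \<pi>" "sets \<pi> = sets E"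
  shows "integrable \<pi> (trans t A)"
proof -
  interpret prob_space \<pi> by fact
  have sp: "space \<pi> = space E" using assms(4) by (rule sets_eq_imp_space_eq)
  have "trans t A \<in> borel_measurable \<pi>"
    using measurable_E[OF measurable_trans[of t A]] assms
    by (simp cong: measurable_cong_sets add: sets_E)
  then show ?thesis
    using trans_bounds by (intro integrable_const_bound[of _ 1]) (auto simp: sp space_E)
qed

lemma measure_bind_P:
  assumes \<pi>: "prob_space \<pi>" "sets \<pi> = sets E" and B: "B \<in> sets \<Omega>"
  shows "measure (\<pi> \<bind> P) B = (\<integral>x. measure (P x) B \<partial>\<pi>)"
proof -
  interpret prob_space \<pi> by fact
  have "P \<in> E \<rightarrow>\<^sub>M subprob_algebra \<Omega>"
    unfolding live_space_def using measurable_P_subprob by (rule measurable_restrict_space1)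
  then have "P \<in> \<pi> \<rightarrow>\<^sub>M subprob_algebra \<Omega>"
    using \<pi>(2) by (simp cong: measurable_cong_sets)
  then show ?thesis using B by (rule measure_bind)
qed

lemma space_bind_P:
  assumes \<pi>: "prob_space \<pi>" "sets \<pi> = sets E"
  shows "space (\<pi> \<bind> P) = space \<Omega>"
proof (rule space_bind)
  show "space \<pi> \<noteq> {}" using \<pi>(1) by (rule prob_space.not_empty)
  show "sets (P x) = sets \<Omega>" if "x \<in> space \<pi>" for x
    using that sets_eq_imp_space_eq[OF \<pi>(2)] by (simp add: sets_P space_E)
qed

lemma prob_bind_X:
  assumes \<pi>: "prob_space \<pi>" "sets \<pi> = sets E" and t: "0 \<le> t" and A: "A \<in> sets E"
  shows "\<P>(\<omega> in \<pi> \<bind> P. X t \<omega> \<in> A) = (\<integral>x. trans t A x \<partial>\<pi>)"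
proof -
  have "\<P>(\<omega> in \<pi> \<bind> P. X t \<omega> \<in> A) = (\<integral>x. measure (P x) {\<omega>\<in>space \<Omega>. X t \<omega> \<in> A} \<partial>\<pi>)"
    using measure_bind_P[OF \<pi> X_event_sets] t A by (simp add: space_bind_P[OF \<pi>] sets_E)
  also have "\<dots> = (\<integral>x. trans t A x \<partial>\<pi>)"
    using sets_eq_imp_space_eq[OF \<pi>(2)]
    by (intro Bochner_Integration.integral_cong) (auto simp: trans_eq space_E)
  finally show ?thesis .
qed

lemma prob_bind_alive:
  assumes \<pi>: "prob_space \<pi>" "sets \<pi> = sets E" and t: "0 \<le> t"
  shows "\<P>(\<omega> in \<pi> \<bind> P. ereal t < absorption_time X cem \<omega>) = (\<integral>x. surv t x \<partial>\<pi>)"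
proof -
  have "\<P>(\<omega> in \<pi> \<bind> P. ereal t < absorption_time X cem \<omega>) = \<P>(\<omega> in \<pi> \<bind> P. X t \<omega> \<in> space E)"
    using t by (simp add: space_bind_P[OF \<pi>] alive_iff cong: conj_cong)
  then show ?thesis using prob_bind_X[OF \<pi> t sets.top] by simp
qed

lemma cond_prob_bind:
  assumes \<pi>: "prob_space \<pi>" "sets \<pi> = sets E" and t: "0 \<le> t" and A: "A \<in> sets E"
  shows "\<P>(\<omega> in \<pi> \<bind> P. X t \<omega> \<in> A \<bar> ereal t < absorption_time X cem \<omega>)
    = (\<integral>x. trans t A x \<partial>\<pi>) / (\<integral>x. surv t x \<partial>\<pi>)"
proof -
  have "\<P>(\<omega> in \<pi> \<bind> P. X t \<omega> \<in> A \<and> ereal t < absorption_time X cem \<omega>) = \<P>(\<omega> in \<pi> \<bind> P. X t \<omega> \<in> A)"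
    using t A by (intro arg_cong[where f = "measure _"])
      (auto simp: space_bind_P[OF \<pi>] alive_iff sets_E)
  then show ?thesis
    unfolding cond_prob_def using prob_bind_alive[OF \<pi> t] prob_bind_X[OF \<pi> t A] by simp
qed

lemma cond_prob_P:
  assumes x: "x \<in> space S" and t: "0 \<le> t" and A: "A \<in> sets E"
  shows "\<P>(\<omega> in P x. X t \<omega> \<in> A \<bar> ereal t < absorption_time X cem \<omega>) = trans t A x / surv t x"
proof -
  have "\<P>(\<omega> in P x. X t \<omega> \<in> A \<and> ereal t < absorption_time X cem \<omega>) = trans t A x"
    unfolding trans_def using x t A by (intro arg_cong[where f = "measure _"])
      (auto simp: space_P alive_iff sets_E)
  then show ?thesis
    unfolding cond_prob_def using surv_eq[OF x t] by simp
qed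

end

section \<open>Contraction of the conditional laws\<close>

text \<open>
  Conditions (A1) and (A2) in terms of transition probabilities. In the first, the division
  by the survival probability has been cleared, so that it integrates directly.
\<close>

locale doeblin_absorbed_process = absorbed_markov_process \<Omega> S X P cem
  for \<Omega> :: "'w measure" and S :: "'s measure"
    and X :: "real \<Rightarrow> 'w \<Rightarrow> 's" and P :: "'s \<Rightarrow> 'w measure" and cem :: 's +
  fixes t0 c1 c2 :: real and \<nu> :: "'s measure"
  assumes surv_pos: "\<And>x t. x \<in> space E \<Longrightarrow> 0 \<le> t \<Longrightarrow> 0 < surv t x"
    and pos: "0 < t0" "0 < c1" "0 < c2"
    and nu: "prob_space \<nu>" "sets \<nu> = sets E"
    and minorization: "\<And>x A. x \<in> space E \<Longrightarrow> A \<in> sets E \<Longrightarrow>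
      c1 * surv t0 x * measure \<nu> A \<le> trans t0 A x"
    and comparison: "\<And>z t. z \<in> space E \<Longrightarrow> 0 \<le> t \<Longrightarrow> c2 * surv t z \<le> (\<integral>x. surv t x \<partial>\<nu>)"
begin

definition sup_surv :: "real \<Rightarrow> real" where
  "sup_surv t = (SUP z\<in>space E. surv t z)"

lemma space_E_nonempty: "space E \<noteq> {}"
  using prob_space.not_empty[OF nu(1)] sets_eq_imp_space_eq[OF nu(2)] by simp

lemma surv_le_sup: "x \<in> space E \<Longrightarrow> surv t x \<le> sup_surv t"
  unfolding sup_surv_def using trans_bounds
  by (intro cSUP_upper bdd_aboveI[of _ 1]) (auto simp: space_E)

lemma sup_surv_pos: "0 \<le> t \<Longrightarrow> 0 < sup_surv t"
  using space_E_nonempty surv_pos surv_le_sup by (metis all_not_in_conv less_le_trans)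

lemma sup_surv_le_1: "sup_surv t \<le> 1"
  unfolding sup_surv_def using space_E_nonempty trans_bounds
  by (intro cSUP_least) (auto simp: space_E)

lemma comparison_sup:
  assumes t: "0 \<le> t"
  shows "c2 * sup_surv t \<le> (\<integral>x. surv t x \<partial>\<nu>)"
proof -
  have "sup_surv t \<le> (\<integral>x. surv t x \<partial>\<nu>) / c2"
    unfolding sup_surv_def using space_E_nonempty comparison[OF _ t] pos
    by (intro cSUP_least) (auto simp: field_simps)
  then show ?thesis using pos by (simp add: field_simps)
qed

lemma surv_integral_pos:
  assumes \<pi>: "prob_space \<pi>" "sets \<pi> = sets E" and t: "0 \<le> t"
  shows "0 < (\<integral>x. surv t x \<partial>\<pi>)"
proof -
  interpret prob_space \<pi> by fact
  have "surv t x > 0" if "x \<in> space \<pi>" for x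
    using that surv_pos t sets_eq_imp_space_eq[OF \<pi>(2)] by simp
  then have "(\<integral>x. surv t x \<partial>\<pi>) > (\<integral>x. 0 \<partial>\<pi>)"
    using trans_integrable[OF t sets.top \<pi>]
    by (intro integral_less_AE_space) (auto simp: emeasure_space_1)
  then show ?thesis by simp
qed

text \<open>
  (A1) extended from sets to functions. The measure \<open>\<nu>\<close> lives on \<open>E\<close> and is
  transported to \<open>S\<close> along the inclusion in order to be compared with the law of \<open>X t0\<close>.
\<close>

lemma minorization_integral:
  assumes x: "x \<in> space S" and f: "f \<in> borel_measurable S"
    "\<And>y. y \<in> space S \<Longrightarrow> 0 \<le> f y" "\<And>y. y \<in> space S \<Longrightarrow> f y \<le> B"
  shows "c1 * surv t0 x * (\<integral>y. f y \<partial>\<nu>) \<le> (\<integral>\<omega>. f (X t0 \<omega>) \<partial>P x)"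
proof -
  have t0: "0 \<le> t0" using pos by simp
  have sp: "space \<nu> = space E" using nu(2) by (rule sets_eq_imp_space_eq)
  have id: "(\<lambda>x. x) \<in> \<nu> \<rightarrow>\<^sub>M S"
  proof (rule measurableI)
    fix A assume A: "A \<in> sets S"
    have "A \<inter> space E \<in> sets E"
      using A space_E_sets by (auto simp: sets_E space_E)
    then show "(\<lambda>x. x) -` A \<inter> space \<nu> \<in> sets \<nu>" by (simp add: sp nu(2))
  qed (simp add: sp space_E)
  have "c1 * surv t0 x * (\<integral>y. f y \<partial>distr \<nu> S (\<lambda>x. x)) \<le> (\<integral>y. f y \<partial>distr (P x) S (X t0))"
  proof (rule integral_mono_scaled_measure[where B = B])
    show "finite_measure (distr (P x) S (X t0))" "finite_measure (distr \<nu> S (\<lambda>x. x))"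
      using prob_space.prob_space_distr[OF prob_space_P[OF x] measurable_X_P[OF t0 x]]
        prob_space.prob_space_distr[OF nu(1) id]
      by (auto simp: prob_space_def)
    show "c1 * surv t0 x * measure (distr \<nu> S (\<lambda>x. x)) A \<le> measure (distr (P x) S (X t0)) A"
      if "A \<in> sets (distr (P x) S (X t0))" for A
    proof -
      have A: "A \<in> sets S" using that by simp
      have AE: "A \<inter> space E \<in> sets E"
        using A space_E_sets by (auto simp: sets_E space_E)
      have "c1 * surv t0 x * measure \<nu> (A \<inter> space E) \<le> trans t0 (A \<inter> space E) x"
      proof (cases "x = cem")
        case True
        then show ?thesis
          using trans_cemetery[OF t0 sets.top] trans_bounds[OF x] by simp
      next
        case False
        then show ?thesis using minorization[OF _ AE] x by (simp add: space_E)
      qed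
      also have "\<dots> \<le> trans t0 A x"
        using A by (intro trans_mono[OF x t0]) auto
      finally show ?thesis
        using A by (simp add: trans_distr[OF t0 x] measure_distr[OF id] sp)
    qed
    show "0 \<le> c1 * surv t0 x" using pos trans_bounds[OF x] by simp
  qed (use f in auto)
  then show ?thesis
    using f(1) by (simp add: integral_distr[OF id] integral_distr[OF measurable_X_P[OF t0 x]])
qed

lemma surv_add_le:
  assumes x: "x \<in> space S" and s: "0 \<le> s"
  shows "surv (t0 + s) x \<le> sup_surv s * surv t0 x"
proof -
  interpret prob_space "P x" using x by (rule prob_space_P)
  have t0: "0 \<le> t0" using pos by simp
  have EX: "space E \<in> sets S" using space_E_sets by (simp add: space_E)
  have ev: "{\<omega>\<in>space \<Omega>. X t0 \<omega> \<in> space E} \<in> events"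
    using X_event_sets[OF t0 EX] x by (simp add: sets_P)
  have "surv (t0 + s) x = (\<integral>\<omega>. surv s (X t0 \<omega>) \<partial>P x)"
    by (rule chapman_kolmogorov[OF x t0 s EX])
  also have "\<dots> \<le> (\<integral>\<omega>. sup_surv s * indicator {\<omega>\<in>space \<Omega>. X t0 \<omega> \<in> space E} \<omega> \<partial>P x)"
  proof (rule integral_mono)
    show "integrable (P x) (\<lambda>\<omega>. surv s (X t0 \<omega>))"
      using measurable_compose[OF measurable_X_P[OF t0 x] measurable_trans[OF s EX]]
        trans_bounds X_in_space[OF t0]
      by (intro integrable_const_bound[of _ 1]) (auto simp: space_P[OF x])
    show "integrable (P x) (\<lambda>\<omega>. sup_surv s * indicator {\<omega>\<in>space \<Omega>. X t0 \<omega> \<in> space E} \<omega>)"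
      using ev by (intro integrable_mult_right integrable_real_indicator) (auto simp: emeasure_eq_measure)
    show "surv s (X t0 \<omega>) \<le> sup_surv s * indicator {\<omega>\<in>space \<Omega>. X t0 \<omega> \<in> space E} \<omega>"
      if "\<omega> \<in> space (P x)" for \<omega>
    proof (cases "X t0 \<omega> \<in> space E")
      case True
      then show ?thesis using that surv_le_sup by (simp add: space_P[OF x])
    next
      case False
      then have "X t0 \<omega> = cem" using X_in_space[OF t0] that by (auto simp: space_P[OF x] space_E)
      then show ?thesis using trans_cemetery[OF s sets.top] False by simp
    qed
  qed
  also have "\<dots> = sup_surv s * surv t0 x"
    using ev by (simp add: trans_eq[OF x])
  finally show ?thesis .
qed

text \<open>
  One Doeblin step. The gaps \<open>F\<close> and \<open>H\<close> to the lower and the upper bound at time \<open>s\<close> are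
  nonnegative, so the minorization raises the lower bound by \<open>l\<close> and decreases the upper bound by
  \<open>u\<close>. Because \<open>F + H = w * surv s\<close>, the two gains together are at least \<open>c1 * c2 * w\<close>, whatever
  \<open>A\<close> is.
\<close>

lemma oscillation_step:
  assumes s: "0 \<le> s" and A: "A \<in> sets E" and w: "0 \<le> w"
    and IH: "\<And>x. x \<in> space S \<Longrightarrow> m * surv s x \<le> trans s A x \<and> trans s A x \<le> (m + w) * surv s x"
  shows "\<exists>m'. \<forall>x\<in>space S. m' * surv (t0 + s) x \<le> trans (t0 + s) A x
    \<and> trans (t0 + s) A x \<le> (m' + (1 - c1 * c2) * w) * surv (t0 + s) x"
proof -
  have t0: "0 \<le> t0" using pos by simp
  have EX: "space E \<in> sets S" and AS: "A \<in> sets S"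
    using space_E_sets A by (auto simp: space_E sets_E)
  define F where "F y = trans s A y - m * surv s y" for y
  define H where "H y = (m + w) * surv s y - trans s A y" for y
  define l where "l = c1 * (\<integral>y. F y \<partial>\<nu>) / sup_surv s"
  define u where "u = c1 * (\<integral>y. H y \<partial>\<nu>) / sup_surv s"
  note G = sup_surv_pos[OF s]
  note intA = trans_integrable[OF s A nu] and intE = trans_integrable[OF s sets.top nu]
  have lu: "c1 * c2 * w \<le> l + u"
  proof -
    have "(\<integral>y. F y \<partial>\<nu>) + (\<integral>y. H y \<partial>\<nu>) = w * (\<integral>y. surv s y \<partial>\<nu>)"
      using intA intE by (simp add: F_def H_def algebra_simps)
    then have "l + u = c1 * w * (\<integral>y. surv s y \<partial>\<nu>) / sup_surv s"
      unfolding l_def u_def by (simp add: add_divide_distrib[symmetric] distrib_left[symmetric])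
    also have "\<dots> \<ge> c1 * w * (c2 * sup_surv s) / sup_surv s"
      using comparison_sup[OF s] G w pos by (intro divide_right_mono mult_left_mono) auto
    finally show ?thesis using G by (simp add: mult_ac)
  qed
  have lower: "c * surv (t0 + s) x \<le> (\<integral>\<omega>. f (X t0 \<omega>) \<partial>P x)"
    if x: "x \<in> space S" and f: "f \<in> borel_measurable S" "\<And>y. y \<in> space S \<Longrightarrow> 0 \<le> f y"
      and bf: "\<And>y. y \<in> space S \<Longrightarrow> f y \<le> w"
      and c: "c = c1 * (\<integral>y. f y \<partial>\<nu>) / sup_surv s"
    for c x and f :: "'s \<Rightarrow> real"
  proof -
    have fnu: "0 \<le> (\<integral>y. f y \<partial>\<nu>)"
      using f(2) sets_eq_imp_space_eq[OF nu(2)] by (intro integral_nonneg_AE AE_I2) (simp add: space_E)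
    then have "0 \<le> c" using c G pos by simp
    then have "c * surv (t0 + s) x \<le> c * (sup_surv s * surv t0 x)"
      by (intro mult_left_mono surv_add_le x s)
    also have "\<dots> = c1 * surv t0 x * (\<integral>y. f y \<partial>\<nu>)"
      using c G by simp
    also have "\<dots> \<le> (\<integral>\<omega>. f (X t0 \<omega>) \<partial>P x)"
      using x f bf by (rule minorization_integral)
    finally show ?thesis .
  qed
  have "(m + l) * surv (t0 + s) x \<le> trans (t0 + s) A x
    \<and> trans (t0 + s) A x \<le> (m + l + (1 - c1 * c2) * w) * surv (t0 + s) x" if x: "x \<in> space S" for x
  proof -
    interpret prob_space "P x" using x by (rule prob_space_P)
    have int: "integrable (P x) (\<lambda>\<omega>. trans s B (X t0 \<omega>))" if "B \<in> sets S" for B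
      using measurable_compose[OF measurable_X_P[OF t0 x] measurable_trans[OF s that]]
        trans_bounds X_in_space[OF t0]
      by (intro integrable_const_bound[of _ 1]) (auto simp: space_P[OF x])
    have meas: "F \<in> borel_measurable S" "H \<in> borel_measurable S"
      unfolding F_def H_def using measurable_trans[OF s EX] measurable_trans[OF s AS]
      by (auto intro!: borel_measurable_diff borel_measurable_times)
    have nonneg: "0 \<le> F y" "0 \<le> H y" if "y \<in> space S" for y
      using IH[OF that] by (auto simp: F_def H_def)
    have le: "F y \<le> w" "H y \<le> w" if y: "y \<in> space S" for y
    proof -
      have "w * surv s y \<le> w * 1" using trans_bounds[OF y] w by (intro mult_left_mono) auto
      moreover have "F y + H y = w * surv s y" by (simp add: F_def H_def algebra_simps)
      ultimately show "F y \<le> w" "H y \<le> w" using nonneg[OF y] by auto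
    qed
    have "(\<integral>\<omega>. F (X t0 \<omega>) \<partial>P x) = trans (t0 + s) A x - m * surv (t0 + s) x"
      "(\<integral>\<omega>. H (X t0 \<omega>) \<partial>P x) = (m + w) * surv (t0 + s) x - trans (t0 + s) A x"
      using int[OF AS] int[OF EX]
      by (simp_all add: F_def H_def chapman_kolmogorov[OF x t0 s AS] chapman_kolmogorov[OF x t0 s EX])
    then have lo: "l * surv (t0 + s) x \<le> trans (t0 + s) A x - m * surv (t0 + s) x"
      and up: "u * surv (t0 + s) x \<le> (m + w) * surv (t0 + s) x - trans (t0 + s) A x"
      using lower[OF x meas(1) nonneg(1) le(1) l_def] lower[OF x meas(2) nonneg(2) le(2) u_def]
      by simp_all
    have "c1 * c2 * w * surv (t0 + s) x \<le> (l + u) * surv (t0 + s) x"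
      using lu trans_bounds[OF x] by (intro mult_right_mono) auto
    then show ?thesis using lo up by (simp add: algebra_simps)
  qed
  then show ?thesis by blast
qed

text \<open>
  Evaluating (A1) on the set \<open>E\<close> gives \<open>c1 \<le> 1\<close>; averaging (A2) at one time gives
  \<open>c2 \<le> 1\<close>. This keeps the widths \<open>(1 - c1 * c2) ^ k\<close> nonnegative.
\<close>

lemma c1_c2_le_1: "c1 * c2 \<le> 1"
proof -
  obtain x where x: "x \<in> space E" using space_E_nonempty by auto
  then have xS: "x \<in> space S" by (simp add: space_E)
  interpret nu: prob_space \<nu> by (rule nu)
  have t0: "0 \<le> t0" using pos by simp
  have "measure \<nu> (space E) = 1"
    using nu.prob_space sets_eq_imp_space_eq[OF nu(2)] by simp
  then have c1: "c1 \<le> 1"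
    using minorization[OF x sets.top] surv_pos[OF x t0] by simp
  have "surv t0 y \<le> sup_surv t0" if "y \<in> space \<nu>" for y
    using that surv_le_sup sets_eq_imp_space_eq[OF nu(2)] by simp
  then have "(\<integral>y. surv t0 y \<partial>\<nu>) \<le> sup_surv t0"
    using trans_integrable[OF t0 sets.top nu] by (intro nu.integral_le_const AE_I2) auto
  then have "c2 * sup_surv t0 \<le> 1 * sup_surv t0"
    using comparison_sup[OF t0] by simp
  then have "c2 \<le> 1" using sup_surv_pos[OF t0] by simp
  then show ?thesis using c1 pos by (simp add: mult_le_one)
qed

lemma oscillation:
  assumes r: "0 \<le> r" and A: "A \<in> sets E"
  shows "\<exists>m. \<forall>x\<in>space S. m * surv (real k * t0 + r) x \<le> trans (real k * t0 + r) A x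
    \<and> trans (real k * t0 + r) A x \<le> (m + (1 - c1 * c2) ^ k) * surv (real k * t0 + r) x"
proof (induction k)
  case 0
  show ?case using trans_bounds trans_le_surv[OF _ r A] by (intro exI[of _ 0]) auto
next
  case (Suc k)
  then obtain m where m: "\<And>x. x \<in> space S \<Longrightarrow>
      m * surv (real k * t0 + r) x \<le> trans (real k * t0 + r) A x
      \<and> trans (real k * t0 + r) A x \<le> (m + (1 - c1 * c2) ^ k) * surv (real k * t0 + r) x"
    by blast
  have "0 \<le> real k * t0 + r" using r pos by simp
  moreover have "0 \<le> (1 - c1 * c2) ^ k" using c1_c2_le_1 by simp
  moreover have "t0 + (real k * t0 + r) = real (Suc k) * t0 + r" by (simp add: algebra_simps)
  ultimately show ?case
    using oscillation_step[OF _ A _ m] by (simp only: power_Suc)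
qed

text \<open>
  The error of replacing the denominator \<open>q(surv t)\<close> by the larger \<open>p(surv t)\<close> has a favourable
  sign as the shifted integrand \<open>F\<close> is nonnegative. That yields the larger of the two
  survival probabilities in the final denominator.
\<close>

lemma conditional_diff_le:
  assumes p: "prob_space p" "sets p = sets E" and q: "prob_space q" "sets q = sets E"
    and D: "\<And>A. A \<in> sets E \<Longrightarrow> measure p A - measure q A \<le> D"
    and r: "0 \<le> r" and t: "t = real k * t0 + r" and A: "A \<in> sets E"
    and le: "(\<integral>x. surv t x \<partial>q) \<le> (\<integral>x. surv t x \<partial>p)"
  shows "(\<integral>x. trans t A x \<partial>p) / (\<integral>x. surv t x \<partial>p) - (\<integral>x. trans t A x \<partial>q) / (\<integral>x. surv t x \<partial>q)
    \<le> (1 - c1 * c2) ^ k * sup_surv t * D / (\<integral>x. surv t x \<partial>p)"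
proof -
  have t_nonneg: "0 \<le> t" using r t pos by simp
  define w where "w = (1 - c1 * c2) ^ k"
  have w: "0 \<le> w" using c1_c2_le_1 by (simp add: w_def)
  obtain m where m: "\<And>x. x \<in> space S \<Longrightarrow>
      m * surv t x \<le> trans t A x \<and> trans t A x \<le> (m + w) * surv t x"
    using oscillation[OF r A, of k] unfolding w_def t by blast
  define F where "F x = trans t A x - m * surv t x" for x
  let ?a = "\<integral>x. surv t x \<partial>p" and ?b = "\<integral>x. surv t x \<partial>q"
  have a: "0 < ?a" and b: "0 < ?b"
    using surv_integral_pos p q t_nonneg by auto
  have sp: "space p = space E" and sq: "space q = space E"
    using sets_eq_imp_space_eq[OF p(2)] sets_eq_imp_space_eq[OF q(2)] by simp_all
  have F0: "0 \<le> F x" if "x \<in> space E" for x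
    using m that by (simp add: F_def space_E)
  have FG: "F x \<le> w * sup_surv t" if x: "x \<in> space E" for x
  proof -
    have "F x \<le> w * surv t x" using m x by (simp add: F_def space_E algebra_simps)
    also have "\<dots> \<le> w * sup_surv t" using surv_le_sup[OF x] w by (rule mult_left_mono)
    finally show ?thesis .
  qed
  have Fp: "(\<integral>x. F x \<partial>p) = (\<integral>x. trans t A x \<partial>p) - m * ?a"
    using trans_integrable[OF t_nonneg A p] trans_integrable[OF t_nonneg sets.top p]
    by (simp add: F_def)
  have Fq: "(\<integral>x. F x \<partial>q) = (\<integral>x. trans t A x \<partial>q) - m * ?b"
    using trans_integrable[OF t_nonneg A q] trans_integrable[OF t_nonneg sets.top q]
    by (simp add: F_def)
  have diff: "(\<integral>x. F x \<partial>p) - (\<integral>x. F x \<partial>q) \<le> w * sup_surv t * D"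
  proof (rule integral_diff_le_sup_diff)
    show "finite_measure p" "finite_measure q"
      using p(1) q(1) by (auto simp: prob_space_def)
    show "F \<in> borel_measurable p"
      unfolding F_def using trans_integrable[OF t_nonneg A p] trans_integrable[OF t_nonneg sets.top p]
      by simp
    show "0 \<le> w * sup_surv t" using w sup_surv_pos[OF t_nonneg] by simp
  qed (use p q D F0 FG sp in auto)
  have "(\<integral>x. trans t A x \<partial>p) / ?a - (\<integral>x. trans t A x \<partial>q) / ?b = (\<integral>x. F x \<partial>p) / ?a - (\<integral>x. F x \<partial>q) / ?b"
    using a b by (simp add: Fp Fq field_simps)
  also have "\<dots> \<le> (\<integral>x. F x \<partial>p) / ?a - (\<integral>x. F x \<partial>q) / ?a"
  proof -
    have "0 \<le> (\<integral>x. F x \<partial>q)" using F0 sq by (intro integral_nonneg_AE AE_I2) simp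
    then show ?thesis using divide_left_mono[OF le] a b by (simp add: mult_pos_pos)
  qed
  also have "\<dots> = ((\<integral>x. F x \<partial>p) - (\<integral>x. F x \<partial>q)) / ?a"
    by (simp add: diff_divide_distrib)
  also have "\<dots> \<le> w * sup_surv t * D / ?a"
    using diff a by (simp add: divide_right_mono)
  finally show ?thesis by (simp add: w_def)
qed

lemma survival_constant_eq:
  assumes \<pi>: "prob_space \<pi>" "sets \<pi> = sets E"
  shows "survival_constant S X P cem \<pi> = (INF t\<in>{0..}. (\<integral>x. surv t x \<partial>\<pi>) / sup_surv t)"
  unfolding survival_constant_def
proof (rule INF_cong)
  fix t :: real assume "t \<in> {0..}"
  then have t: "0 \<le> t" by simp
  have "(SUP z\<in>space E. \<P>(\<omega> in P z. ereal t < absorption_time X cem \<omega>)) = sup_surv t"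
    unfolding sup_surv_def using surv_eq[OF _ t] by (intro SUP_cong) (auto simp: space_E)
  then show "\<P>(\<omega> in \<pi> \<bind> P. ereal t < absorption_time X cem \<omega>) /
      (SUP z\<in>space E. \<P>(\<omega> in P z. ereal t < absorption_time X cem \<omega>))
    = (\<integral>x. surv t x \<partial>\<pi>) / sup_surv t"
    using prob_bind_alive[OF \<pi> t] by simp
qed simp

lemma survival_constant_le:
  assumes \<pi>: "prob_space \<pi>" "sets \<pi> = sets E" and t: "0 \<le> t"
  shows "survival_constant S X P cem \<pi> \<le> (\<integral>x. surv t x \<partial>\<pi>) / sup_surv t"
  unfolding survival_constant_eq[OF \<pi>]
proof (rule cINF_lower)
  have "0 \<le> (\<integral>x. surv s x \<partial>\<pi>) / sup_surv s" if "0 \<le> s" for s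
    using surv_integral_pos[OF \<pi> that] sup_surv_pos[OF that] by simp
  then show "bdd_below ((\<lambda>t. (\<integral>x. surv t x \<partial>\<pi>) / sup_surv t) ` {0..})"
    by (intro bdd_belowI[of _ 0]) auto
qed (use t in simp)

lemma surv_add_ge:
  assumes x: "x \<in> space S" and s: "0 \<le> s"
  shows "c1 * c2 * sup_surv s * surv t0 x \<le> surv (t0 + s) x"
proof -
  have t0: "0 \<le> t0" using pos by simp
  have EX: "space E \<in> sets S" using space_E_sets by (simp add: space_E)
  have "c1 * c2 * sup_surv s * surv t0 x = c1 * surv t0 x * (c2 * sup_surv s)"
    by (simp add: mult_ac)
  also have "\<dots> \<le> c1 * surv t0 x * (\<integral>y. surv s y \<partial>\<nu>)"
    using comparison_sup[OF s] pos trans_bounds[OF x] by (intro mult_left_mono) auto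
  also have "\<dots> \<le> (\<integral>\<omega>. surv s (X t0 \<omega>) \<partial>P x)"
    using trans_bounds by (intro minorization_integral[OF x measurable_trans[OF s EX], of 1]) auto
  also have "\<dots> = surv (t0 + s) x" by (rule chapman_kolmogorov[OF x t0 s EX, symmetric])
  finally show ?thesis .
qed

text \<open>
  The value \<open>c1 * c2 * \<pi>(surv t0)\<close> is a positive lower bound of the quotients: for \<open>t \<ge> t0\<close> by
  running the process for time \<open>t0\<close> first, for \<open>t < t0\<close> by monotonicity of survival in time.
  Positivity is what makes \<open>1 / c(\<pi>)\<close> an upper bound: at \<open>c(\<pi>) = 0\<close> it would be 0 by convention.
\<close>

lemma survival_constant_pos:
  assumes \<pi>: "prob_space \<pi>" "sets \<pi> = sets E"
  shows "0 < survival_constant S X P cem \<pi>"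
proof -
  have t0: "0 \<le> t0" using pos by simp
  let ?s0 = "\<integral>x. surv t0 x \<partial>\<pi>"
  have s0: "0 < ?s0" by (rule surv_integral_pos[OF \<pi> t0])
  have sp: "space \<pi> = space E" using \<pi>(2) by (rule sets_eq_imp_space_eq)
  have low: "c1 * c2 * ?s0 \<le> (\<integral>x. surv t x \<partial>\<pi>) / sup_surv t" if t: "0 \<le> t" for t
  proof (cases "t0 \<le> t")
    case False
    have "c1 * c2 * ?s0 \<le> 1 * ?s0"
      using c1_c2_le_1 s0 by (intro mult_right_mono) auto
    also have "\<dots> \<le> (\<integral>x. surv t x \<partial>\<pi>)"
      using False t trans_integrable[OF _ sets.top \<pi>] t0 surv_antimono[of _ t t0] sp
      by simp (intro integral_mono; simp add: space_E)
    also have "\<dots> \<le> (\<integral>x. surv t x \<partial>\<pi>) / sup_surv t"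
      using sup_surv_le_1 sup_surv_pos[OF t] surv_integral_pos[OF \<pi> t]
      by (simp add: field_simps mult_left_le)
    finally show ?thesis .
  next
    case True
    define s where "s = t - t0"
    have s: "0 \<le> s" and ts: "t = t0 + s" using True by (auto simp: s_def)
    have "sup_surv t \<le> sup_surv s"
      unfolding sup_surv_def[of t]
    proof (rule cSUP_least[OF space_E_nonempty])
      fix x assume x: "x \<in> space E"
      have "surv t x \<le> surv s x" using surv_antimono[of x s t] s x ts t0 by (simp add: space_E)
      also have "\<dots> \<le> sup_surv s" using x by (rule surv_le_sup)
      finally show "surv t x \<le> sup_surv s" .
    qed
    then have "c1 * c2 * ?s0 * sup_surv t \<le> c1 * c2 * ?s0 * sup_surv s"
      using pos s0 by (intro mult_left_mono) auto
    also have "\<dots> = (\<integral>x. c1 * c2 * sup_surv s * surv t0 x \<partial>\<pi>)"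
      by simp
    also have "\<dots> \<le> (\<integral>x. surv t x \<partial>\<pi>)"
      unfolding ts using surv_add_ge[OF _ s] trans_integrable[OF _ sets.top \<pi>] t0 s sp
      by (intro integral_mono) (auto simp: space_E)
    finally show ?thesis using sup_surv_pos[OF t] by (simp add: field_simps)
  qed
  have "c1 * c2 * ?s0 \<le> survival_constant S X P cem \<pi>"
    unfolding survival_constant_eq[OF \<pi>] using low by (intro cINF_greatest) auto
  moreover have "0 < c1 * c2 * ?s0" using pos s0 by simp
  ultimately show ?thesis by linarith
qed

lemma conditional_tv_norm_le_of_survival_le:
  assumes p: "prob_space p" "sets p = sets E" and q: "prob_space q" "sets q = sets E"
    and t: "0 \<le> t"
    and le: "(\<integral>x. surv t x \<partial>q) \<le> (\<integral>x. surv t x \<partial>p)"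
  shows "tv_norm E (\<lambda>A. (\<integral>x. trans t A x \<partial>p) / (\<integral>x. surv t x \<partial>p)
                      - (\<integral>x. trans t A x \<partial>q) / (\<integral>x. surv t x \<partial>q))
    \<le> (1 - c1 * c2) ^ nat \<lfloor>t / t0\<rfloor>
        / max (survival_constant S X P cem p) (survival_constant S X P cem q)
        * tv_norm E (\<lambda>A. measure p A - measure q A)" (is "tv_norm E ?\<Delta> \<le> ?w / ?c * ?V")
proof -
  interpret p: prob_space p by fact
  interpret q: prob_space q by fact
  have sp: "space p = space E" and sq: "space q = space E"
    using sets_eq_imp_space_eq[OF p(2)] sets_eq_imp_space_eq[OF q(2)] by simp_all
  define k where "k = nat \<lfloor>t / t0\<rfloor>"
  define r where "r = t - real k * t0"
  have "real k \<le> t / t0"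
    using t pos by (simp add: k_def)
  then have r: "0 \<le> r" and tr: "t = real k * t0 + r"
    using pos by (auto simp: r_def field_simps)
  have w: "0 \<le> ?w" using c1_c2_le_1 by simp
  let ?a = "\<integral>x. surv t x \<partial>p" and ?b = "\<integral>x. surv t x \<partial>q"
  have a: "0 < ?a" and b: "0 < ?b"
    using surv_integral_pos p q t by auto
  have V: "measure p A - measure q A \<le> ?V / 2" if A: "A \<in> sets E" for A
  proof -
    have "2 * (measure p A - measure q A) \<le> ?V"
    proof (rule le_tv_norm[where D = 1, OF _ _ _ A])
      show "additive (sets E) (\<lambda>A. measure p A - measure q A)"
        using p(2) q(2) by (auto simp: additive_def p.finite_measure_Union q.finite_measure_Union)
      show "measure p (space E) - measure q (space E) = 0"
        using p.prob_space q.prob_space sp sq by simp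
      show "measure p B - measure q B \<le> 1" for B
        using p.prob_le_1[of B] measure_nonneg[of q B] by linarith
    qed
    then show ?thesis by simp
  qed
  have V_nonneg: "0 \<le> ?V" using V[of "{}"] by simp
  have "tv_norm E ?\<Delta> \<le> 2 * (?w * sup_surv t * (?V / 2) / ?a)"
  proof (rule tv_norm_le)
    have add: "(\<integral>x. trans t (A \<union> B) x \<partial>\<pi>) = (\<integral>x. trans t A x \<partial>\<pi>) + (\<integral>x. trans t B x \<partial>\<pi>)"
      if "A \<in> sets E" "B \<in> sets E" "A \<inter> B = {}" and \<pi>: "prob_space \<pi>" "sets \<pi> = sets E"
      for A B \<pi>
    proof -
      have "(\<integral>x. trans t (A \<union> B) x \<partial>\<pi>) = (\<integral>x. trans t A x + trans t B x \<partial>\<pi>)"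
        using that t sets_eq_imp_space_eq[OF \<pi>(2)]
        by (intro Bochner_Integration.integral_cong) (auto simp: trans_additive sets_E space_E)
      then show ?thesis using that t trans_integrable by simp
    qed
    show "additive (sets E) ?\<Delta>"
      using add p q by (auto simp: additive_def add_divide_distrib)
    show "?\<Delta> (space E) = 0" using a b by simp
    show "?\<Delta> A \<le> ?w * sup_surv t * (?V / 2) / ?a" if "A \<in> sets E" for A
      using conditional_diff_le[OF p q V r tr that le] by (simp add: k_def)
  qed
  also have "\<dots> = ?w * ?V * (sup_surv t / ?a)" by simp
  also have "\<dots> \<le> ?w * ?V * (1 / ?c)"
  proof (intro mult_left_mono)
    have "?c \<le> ?a / sup_surv t"
    proof (rule max.boundedI)
      show "survival_constant S X P cem p \<le> ?a / sup_surv t"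
        by (rule survival_constant_le[OF p t])
      have "survival_constant S X P cem q \<le> ?b / sup_surv t"
        by (rule survival_constant_le[OF q t])
      also have "\<dots> \<le> ?a / sup_surv t"
        using le sup_surv_pos[OF t] by (simp add: divide_right_mono)
      finally show "survival_constant S X P cem q \<le> ?a / sup_surv t" .
    qed
    moreover have "0 < ?c" using survival_constant_pos[OF p] by simp
    ultimately show "sup_surv t / ?a \<le> 1 / ?c"
      using a sup_surv_pos[OF t] le_imp_inverse_le[of ?c "?a / sup_surv t"]
      by (simp add: divide_inverse mult.commute)
  qed (use w V_nonneg in simp)
  finally show ?thesis by simp
qed

lemma conditional_tv_norm_le:
  assumes p: "prob_space p" "sets p = sets E" and q: "prob_space q" "sets q = sets E"
    and t: "0 \<le> t"
  shows "tv_norm E (\<lambda>A. (\<integral>x. trans t A x \<partial>p) / (\<integral>x. surv t x \<partial>p)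
                      - (\<integral>x. trans t A x \<partial>q) / (\<integral>x. surv t x \<partial>q))
    \<le> (1 - c1 * c2) ^ nat \<lfloor>t / t0\<rfloor>
        / max (survival_constant S X P cem p) (survival_constant S X P cem q)
        * tv_norm E (\<lambda>A. measure p A - measure q A)"
proof (cases "(\<integral>x. surv t x \<partial>q) \<le> (\<integral>x. surv t x \<partial>p)")
  case True
  then show ?thesis by (rule conditional_tv_norm_le_of_survival_le[OF p q t])
next
  case False
  then have "(\<integral>x. surv t x \<partial>p) \<le> (\<integral>x. surv t x \<partial>q)" by simp
  from conditional_tv_norm_le_of_survival_le[OF q p t this] show ?thesis
    unfolding tv_norm_diff_commute[of _ _ "\<lambda>A. (\<integral>x. trans t A x \<partial>q) / (\<integral>x. surv t x \<partial>q)"]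
      tv_norm_diff_commute[of _ _ "measure q"]
    by (simp only: max.commute)
qed

end

theorem mainTheorem4:
  fixes \<Omega> :: "'w measure" and S :: "'s measure"
    and X :: "real \<Rightarrow> 'w \<Rightarrow> 's" and P :: "'s \<Rightarrow> 'w measure" and cem :: 's
    and t0 c1 c2 t :: real and \<nu> \<pi>1 \<pi>2 :: "'s measure"
  defines "E \<equiv> live_space S cem"
    and "\<tau> \<equiv> absorption_time X cem"
    and "c \<equiv> survival_constant S X P cem"
  assumes process: "absorbed_markov_process \<Omega> S X P cem"
    and survival: "\<And>x t. \<lbrakk>x \<in> space E; 0 \<le> t\<rbrakk> \<Longrightarrow> \<P>(\<omega> in P x. ereal t < \<tau> \<omega>) > 0"
    and pos: "t0 > 0" "c1 > 0" "c2 > 0"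
    and nu: "prob_space \<nu>" "sets \<nu> = sets E"
    and A1: "\<And>x A. \<lbrakk>x \<in> space E; A \<in> sets E\<rbrakk> \<Longrightarrow>
      \<P>(\<omega> in P x. X t0 \<omega> \<in> A \<bar> ereal t0 < \<tau> \<omega>) \<ge> c1 * measure \<nu> A"
    and A2: "\<And>z t. \<lbrakk>z \<in> space E; 0 \<le> t\<rbrakk> \<Longrightarrow>
      \<P>(\<omega> in \<nu> \<bind> P. ereal t < \<tau> \<omega>) \<ge> c2 * \<P>(\<omega> in P z. ereal t < \<tau> \<omega>)"
    and pi1: "prob_space \<pi>1" "sets \<pi>1 = sets E"
    and pi2: "prob_space \<pi>2" "sets \<pi>2 = sets E"
    and t: "0 \<le> t"
  shows "tv_norm E (\<lambda>A. \<P>(\<omega> in \<pi>1 \<bind> P. X t \<omega> \<in> A \<bar> ereal t < \<tau> \<omega>)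
                      - \<P>(\<omega> in \<pi>2 \<bind> P. X t \<omega> \<in> A \<bar> ereal t < \<tau> \<omega>))
    \<le> (1 - c1 * c2) ^ nat \<lfloor>t / t0\<rfloor> / max (c \<pi>1) (c \<pi>2)
        * tv_norm E (\<lambda>A. measure \<pi>1 A - measure \<pi>2 A)"
proof -
  interpret absorbed_markov_process \<Omega> S X P cem by (rule process)
  note defs = E_def \<tau>_def c_def
  have t0: "0 \<le> t0" using pos by simp
  interpret doeblin_absorbed_process \<Omega> S X P cem t0 c1 c2 \<nu>
  proof (intro doeblin_absorbed_process.intro doeblin_absorbed_process_axioms.intro process)
    show surv_pos: "0 < surv t x" if "x \<in> space (live_space S cem)" "0 \<le> t" for x t
      using survival[unfolded defs, OF that] that by (simp add: surv_eq space_E)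
    show "c1 * surv t0 x * measure \<nu> A \<le> trans t0 A x"
      if "x \<in> space (live_space S cem)" "A \<in> sets (live_space S cem)" for x A
      using A1[unfolded defs, OF that] cond_prob_P[OF _ t0 that(2), of x] surv_pos[OF that(1) t0] that(1)
      by (simp add: space_E field_simps)
    show "c2 * surv t z \<le> (\<integral>x. surv t x \<partial>\<nu>)"
      if "z \<in> space (live_space S cem)" "0 \<le> t" for z t
      using A2[unfolded defs, OF that] prob_bind_alive[OF nu[unfolded defs] that(2)] that
      by (simp add: surv_eq space_E)
    show "prob_space \<nu>" "sets \<nu> = sets (live_space S cem)"
      using nu[unfolded defs] by blast+
  qed (rule pos)+
  note p1 = pi1[unfolded defs] and p2 = pi2[unfolded defs]
  have "tv_norm (live_space S cem)
      (\<lambda>A. \<P>(\<omega> in \<pi>1 \<bind> P. X t \<omega> \<in> A \<bar> ereal t < absorption_time X cem \<omega>)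
         - \<P>(\<omega> in \<pi>2 \<bind> P. X t \<omega> \<in> A \<bar> ereal t < absorption_time X cem \<omega>))
    = tv_norm (live_space S cem)
      (\<lambda>A. (\<integral>x. trans t A x \<partial>\<pi>1) / (\<integral>x. surv t x \<partial>\<pi>1)
         - (\<integral>x. trans t A x \<partial>\<pi>2) / (\<integral>x. surv t x \<partial>\<pi>2))"
    by (rule tv_norm_cong) (simp add: cond_prob_bind[OF p1 t] cond_prob_bind[OF p2 t])
  then show ?thesis
    unfolding defs using conditional_tv_norm_le[OF p1 p2 t] by simp
qed

end
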